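(* Let $m\ge 0$ be an integer and let $\phi\in\mathbb{C}$ with $\Re(\phi)\neq 0$. Put $\sigma=\operatorname{sgn}(\Re(\phi))$. Then $$S_{2m+2}(\phi)=\frac{(2\phi)^{2m+2}}{(2m+1)!}\sum_{i=0}^{m} c_{2i+1}^{(m)}\,\mathcal{L}_{e^{-\sigma \phi}}(2i+1),$$ where the $c_{2i+1}^{(m)}$ are the real numbers $$c_{2i+1}^{(m)}=\frac{(2m+1)!}{(2i+1)!}\,\frac{B_{2m-2i}^{(2m+2)}(m+1)}{(2m-2i)!},\qquad 0\le i\le m.$$
   Context: For an integer $m\ge 0$ and $\phi\in\mathbb{C}$ with $\Re(\phi)\ne0$, $S_{2m+2}(\phi)=\sum_{n=1}^\infty \frac{\phi^{2m+2}}{\sinh^{2m+2}(n\phi/2)}$. For $s\in\mathbb{R}$ and $q\in\mathbb{C}$ with $|q|<1$, the Lambert series is $\mathcal{L}_q(s)=\sum_{k=1}^\infty \frac{k^s q^k}{1-q^k}$. For an integer $r\ge 0$ and real $t$, the generalized Bernoulli polynomials $B_n^{(r)}(t)$ are defined by $\frac{x^r}{(e^x-1)^r}e^{tx}=\sum_{n=0}^\infty \frac{B_n^{(r)}(t)}{n!}x^n$ for $|x|<2\pi$. *)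

theory Defs
  imports "HOL-Complex_Analysis.Complex_Analysis" "HOL-Real_Asymp.Real_Asymp"
begin

text \<open>The summation index of an infinite series is shifted by one: \<open>Suc n\<close> runs over the
  positive integers.\<close>

definition S_series :: "nat \<Rightarrow> complex \<Rightarrow> complex" where
  "S_series k \<phi> = (\<Sum>n. \<phi> ^ k / sinh (of_nat (Suc n) * \<phi> / 2) ^ k)"

definition lambert :: "complex \<Rightarrow> real \<Rightarrow> complex" where
  "lambert q s = (\<Sum>n. of_real (real (Suc n) powr s) * q ^ Suc n / (1 - q ^ Suc n))"

text \<open>\<open>gen_bernpoly r n t\<close> is $B_n^{(r)}(t)$, read off from the generating function as a formal
  power series; \<open>gen_bernpoly_sums\<close> below is the generating function identity for
  $0 < |x| < 2\pi$.\<close>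

definition gen_bernpoly :: "nat \<Rightarrow> nat \<Rightarrow> real \<Rightarrow> real" where
  "gen_bernpoly r n t =
     fact n * fps_nth (fps_X ^ r / (fps_exp 1 - 1) ^ r * fps_exp t) n"

text \<open>\<open>c_coeff m i\<close> is $c_{2i+1}^{(m)}$, for \<open>i \<le> m\<close>.\<close>

definition c_coeff :: "nat \<Rightarrow> nat \<Rightarrow> real" where
  "c_coeff m i = fact (2 * m + 1) / fact (2 * i + 1) *
     (gen_bernpoly (2 * m + 2) (2 * m - 2 * i) (real m + 1) / fact (2 * m - 2 * i))"

lemma summable_S_series:
  assumes "Re \<phi> \<noteq> 0" "k > 0"
  shows "summable (\<lambda>n. \<phi> ^ k / sinh (of_nat (Suc n) * \<phi> / 2) ^ k)"
proof -
  define a where "a = \<bar>Re \<phi>\<bar> / 2"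
  have a: "a > 0" using assms by (simp add: a_def)
  define C where "C = 2 / (1 - exp (-2 * a))"
  have C: "C > 0" using a by (simp add: C_def)
  have bd: "norm (\<phi> ^ k / sinh (of_nat (Suc n) * \<phi> / 2) ^ k)
              \<le> norm \<phi> ^ k * C ^ k * (exp (- a * real k)) ^ Suc n" for n
  proof -
    define b where "b = real (Suc n) * a"
    define z where "z = of_nat (Suc n) * \<phi> / 2"
    have "a \<le> b" using a by (simp add: b_def)
    have b0: "b > 0" using a \<open>a \<le> b\<close> by linarith
    have "b = \<bar>Re z\<bar>" by (simp add: b_def a_def z_def abs_mult del: of_nat_Suc)
    have "exp b - exp (-b) \<le> \<bar>norm (exp z) - norm (exp (-z))\<bar>"
      using \<open>b = \<bar>Re z\<bar>\<close> by (cases "Re z \<ge> 0") auto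
    also have "\<dots> \<le> norm (exp z - exp (-z))" by (rule norm_triangle_ineq3)
    finally have sb: "(exp b - exp (-b)) / 2 \<le> norm (sinh z)"
      by (simp add: sinh_field_def norm_divide)
    have "exp (-2 * b) \<le> exp (-2 * a)" using \<open>a \<le> b\<close> by simp
    hence "exp b * (1 - exp (-2 * a)) \<le> exp b * (1 - exp (-2 * b))" by simp
    also have "\<dots> = exp b - exp (-b)" by (simp add: algebra_simps flip: exp_add)
    finally have "exp b / C \<le> norm (sinh z)"
      using sb by (simp add: C_def)
    hence "inverse (norm (sinh z)) \<le> inverse (exp b / C)"
      using C by (intro le_imp_inverse_le) simp_all
    hence "inverse (norm (sinh z)) \<le> C * exp (- b)" by (simp add: exp_minus field_simps)
    hence "inverse (norm (sinh z)) ^ k \<le> (C * exp (- b)) ^ k" by (intro power_mono) simp_all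
    also have "\<dots> = C ^ k * (exp (- a * real k)) ^ Suc n"
    proof -
      have "exp (- b) ^ k = exp (- a * real k) ^ Suc n"
        unfolding b_def exp_of_nat_mult [symmetric] by (rule arg_cong [of _ _ exp]) simp
      thus ?thesis by (simp only: power_mult_distrib)
    qed
    finally have le: "inverse (norm (sinh z)) ^ k \<le> C ^ k * (exp (- a * real k)) ^ Suc n" .
    have "norm (\<phi> ^ k / sinh z ^ k) = norm \<phi> ^ k * inverse (norm (sinh z)) ^ k"
      by (simp add: norm_mult norm_inverse norm_power divide_inverse power_inverse)
    also have "\<dots> \<le> norm \<phi> ^ k * (C ^ k * (exp (- a * real k)) ^ Suc n)"
      by (intro mult_left_mono le) simp
    finally show ?thesis by (simp only: z_def mult.assoc)
  qed
  have "summable (\<lambda>n. norm \<phi> ^ k * C ^ k * (exp (- a * real k)) ^ Suc n)"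
    using a assms by (intro summable_mult) (simp add: summable_Suc_iff del: power_Suc)
  thus ?thesis by (rule summable_comparison_test'[where N = 0]) (use bd in blast)
qed

lemma summable_lambert:
  fixes q :: complex
  assumes "norm q < 1"
  shows "summable (\<lambda>n. of_real (real (Suc n) powr s) * q ^ Suc n / (1 - q ^ Suc n))"
proof (cases "q = 0")
  case False
  define x where "x = norm q"
  have x: "0 < x" "x < 1" using False assms by (auto simp: x_def)
  have y: "0 < (1 + x) / 2" "(1 + x) / 2 < 1" using x by auto
  have "(\<lambda>n. real n powr s * x ^ n) \<in> O(\<lambda>n. ((1 + x) / 2) ^ n)"
    using x by real_asymp
  hence "summable (\<lambda>n. real n powr s * x ^ n)"
    by (rule summable_comparison_test_bigo[rotated]) (use y in \<open>simp add: norm_power\<close>)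
  hence "summable (\<lambda>n. real (Suc n) powr s * x ^ Suc n)"
    by (subst summable_Suc_iff)
  hence sm: "summable (\<lambda>n. real (Suc n) powr s * x ^ Suc n * (1 / (1 - x)))"
    by (rule summable_mult2)
  have bd: "norm (of_real (real (Suc n) powr s) * q ^ Suc n / (1 - q ^ Suc n))
          \<le> real (Suc n) powr s * x ^ Suc n * (1 / (1 - x))" for n
  proof -
    have "x ^ Suc n \<le> x" using power_decreasing[of 1 "Suc n" x] x by simp
    moreover have "1 - x ^ Suc n \<le> norm (1 - q ^ Suc n)"
      using norm_triangle_ineq2[of 1 "q ^ Suc n"] by (simp add: x_def norm_power del: power_Suc)
    ultimately have "1 - x \<le> norm (1 - q ^ Suc n)" by linarith
    hence "1 / norm (1 - q ^ Suc n) \<le> 1 / (1 - x)"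
      using x by (intro divide_left_mono mult_pos_pos) auto
    hence "(real (Suc n) powr s * x ^ Suc n) * (1 / norm (1 - q ^ Suc n))
        \<le> (real (Suc n) powr s * x ^ Suc n) * (1 / (1 - x))"
      using x by (intro mult_left_mono) auto
    thus ?thesis
      by (simp add: norm_mult norm_divide norm_power x_def del: power_Suc of_nat_Suc)
  qed
  show ?thesis
    by (rule summable_comparison_test'[OF sm, where N = 0]) (use bd in blast)
qed simp

lemma subdegree_fps_exp_minus_1: "subdegree (fps_exp 1 - 1 :: 'a :: field_char_0 fps) = 1"
  by (rule subdegreeI) auto

lemma fps_bern_times:
  fixes u :: "'a :: field_char_0"
  shows "fps_X ^ r / (fps_exp 1 - 1) ^ r * fps_exp u * (fps_exp 1 - 1) ^ r = fps_X ^ r * fps_exp u"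
proof -
  have "(fps_exp 1 - 1 :: 'a fps) ^ r \<noteq> 0"
    using subdegree_fps_exp_minus_1[where 'a = 'a] by force
  hence "fps_X ^ r / (fps_exp 1 - 1) ^ r * (fps_exp 1 - 1 :: 'a fps) ^ r = fps_X ^ r"
    by (rule fps_times_divide_eq)
       (unfold subdegree_power subdegree_fps_exp_minus_1, simp)
  thus ?thesis by (metis (no_types, lifting) mult.assoc mult.commute)
qed

lemma gen_bernpoly_complex:
  "of_real (gen_bernpoly r n t) =
     fact n * fps_nth (fps_X ^ r / (fps_exp 1 - 1) ^ r * fps_exp (of_real t :: complex)) n"
proof -
  define h :: "real fps \<Rightarrow> complex fps" where "h = (\<lambda>F. Abs_fps (\<lambda>n. of_real (fps_nth F n)))"
  have h_mult: "h (F * G) = h F * h G" for F G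
    by (rule fps_ext) (simp add: h_def fps_mult_nth)
  have h_1: "h 1 = 1" by (rule fps_ext) (simp add: h_def)
  have h_power: "h (F ^ k) = h F ^ k" for F k
    by (induction k) (simp_all add: h_1 h_mult)
  have h_X: "h fps_X = fps_X" by (rule fps_ext) (simp add: h_def)
  have h_exp: "h (fps_exp u) = fps_exp (of_real u)" for u
    by (rule fps_ext) (simp add: h_def)
  have h_D: "h (fps_exp 1 - 1) = fps_exp 1 - 1"
    by (rule fps_ext) (simp add: h_def)
  let ?F = "fps_X ^ r / (fps_exp 1 - 1) ^ r * fps_exp t"
  let ?G = "fps_X ^ r / (fps_exp 1 - 1) ^ r * fps_exp (of_real t :: complex)"
  have "h ?F * (fps_exp 1 - 1) ^ r = h (?F * (fps_exp 1 - 1) ^ r)"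
    by (simp only: h_mult h_power h_D)
  also have "\<dots> = ?G * (fps_exp 1 - 1) ^ r"
    by (simp only: fps_bern_times h_mult h_power h_X h_exp)
  finally have "h ?F = ?G" using subdegree_fps_exp_minus_1[where 'a = complex] by force
  hence "fps_nth ?G n = of_real (fps_nth ?F n)" by (simp add: h_def fps_eq_iff)
  thus ?thesis by (simp add: gen_bernpoly_def)
qed

lemma gen_bernpoly_sums:
  fixes x :: complex
  assumes "x \<noteq> 0" "norm x < 2 * pi"
  shows "(\<lambda>n. of_real (gen_bernpoly r n t) / fact n * x ^ n) sums
           (x ^ r / (exp x - 1) ^ r * exp (of_real t * x))"
proof -
  define D :: "complex fps" where "D = (fps_exp 1 - 1) ^ r"
  define Q where "Q = fps_X ^ r / D"
  have rad1: "fps_conv_radius (fps_exp 1 - 1 :: complex fps) = \<infinity>"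
    using fps_conv_radius_diff[of "fps_exp 1 :: complex fps" 1] by simp
  have radD: "fps_conv_radius D = \<infinity>"
    using fps_conv_radius_power[of "fps_exp 1 - 1 :: complex fps" r] rad1 by (simp add: D_def)
  have radX: "fps_conv_radius (fps_X ^ r :: complex fps) = \<infinity>"
    using fps_conv_radius_power[of "fps_X :: complex fps" r] by simp
  have evD: "eval_fps D z = (exp z - 1) ^ r" for z
    by (simp add: D_def eval_fps_power rad1 eval_fps_diff)
  have evX: "eval_fps (fps_X ^ r) z = z ^ r" for z :: complex
    by (simp add: eval_fps_power)
  have sub: "subdegree D \<le> subdegree (fps_X ^ r :: complex fps)"
    unfolding D_def subdegree_power subdegree_fps_exp_minus_1 by simp
  have nz: "eval_fps D z \<noteq> 0" if "z \<in> eball 0 (ereal (2 * pi))" "z \<noteq> 0" for z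
  proof
    assume "eval_fps D z = 0"
    hence "exp z = 1" by (simp add: evD)
    then obtain n :: int where n: "Re z = 0" "Im z = of_int (2 * n) * pi"
      by (auto simp: exp_eq_1)
    with that(2) have "n \<noteq> 0" by (auto simp: complex_eq_iff)
    hence "1 \<le> \<bar>real_of_int n\<bar>" by linarith
    hence "2 * pi \<le> \<bar>Im z\<bar>" by (simp add: n abs_mult)
    with abs_Im_le_cmod[of z] that(1) show False by simp
  qed
  have Q: "fps_conv_radius Q \<ge> ereal (2 * pi)" "eval_fps Q x = x ^ r / (exp x - 1) ^ r"
    using fps_conv_radius_divide[where r = "ereal (2 * pi)", OF sub _ _ _ nz]
      eval_fps_divide[where r = "ereal (2 * pi)" and z = x, OF sub _ _ _ nz _ refl] assms
    by (simp_all add: Q_def radD radX evD evX)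
  define F where "F = Q * fps_exp (of_real t)"
  have lt: "ereal (norm x) < fps_conv_radius Q"
    using assms Q(1) by (meson less_ereal.simps(1) less_le_trans)
  have radF: "ereal (norm x) < fps_conv_radius F"
    using fps_conv_radius_mult[of Q "fps_exp (of_real t)"] lt
    by (simp add: F_def less_le_trans)
  have "eval_fps F x = x ^ r / (exp x - 1) ^ r * exp (of_real t * x)"
    using lt by (simp add: F_def eval_fps_mult Q)
  moreover have "fps_nth F n = of_real (gen_bernpoly r n t) / fact n" for n
    by (simp add: gen_bernpoly_complex F_def Q_def D_def)
  ultimately show ?thesis using sums_eval_fps[OF radF] by simp
qed

end

theory Submission
  imports Defs
begin

text \<open>Since \<open>sinh\<close> is odd and the exponent \<open>2 * m + 2\<close> is even, \<open>\<phi>\<close> may be replaced by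
  \<open>\<sigma> * \<phi>\<close>, which has positive real part. With \<open>q = exp (- \<sigma> * \<phi>)\<close> and \<open>y = q ^ n\<close>, the \<open>n\<close>-th
  term of \<open>S_series\<close> is then $(2\phi)^{2m+2}\, y^{m+1}/(1-y)^{2m+2}$, and Newton's binomial series
  turns it into a power series in \<open>y\<close>:
  $$\frac{y^{m+1}}{(1-y)^{2m+2}} = \sum_{j\ge1} \binom{j+m}{2m+1} y^j$$
  (\<open>shifted_binomial_sums\<close>; the terms with $j \le m$ vanish).

  As a polynomial in $j$, the binomial coefficient is $(j+m)(j+m-1)\cdots(j-m)/(2m+1)!$, an odd
  function of $j$. Its coefficients are the numbers \<open>c_coeff m i\<close>, divided by \<open>(2m+1)!\<close>
  (\<open>binomial_eq_sum_odd_powers\<close>). This comes from the closed form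
  $B_n^{(n+1)}(t+1)/n! = \binom{t}{n}$ with $n = 2m+1$ and $t = j+m$: the generating function of
  $B^{(2m+2)}(j+m+1)$ is $e^{jx}$ times that of $B^{(2m+2)}(m+1)$, and the latter is
  $(x/(2\sinh(x/2)))^{2m+2}$, an even function, so that only odd powers of $j$ survive.

  It remains to sum $j^{2i+1} q^{nj}$ over \<open>n\<close> and \<open>j\<close>. The double series converges absolutely;
  summing over \<open>n\<close> first gives a geometric series for each \<open>j\<close>, hence the Lambert series
  (\<open>lambert_double_sum\<close>).\<close>

section \<open>Generating functions of the generalized Bernoulli polynomials\<close>

definition fps_expm1 :: "real fps" where "fps_expm1 = fps_exp 1 - 1"

lemma fps_expm1_neq_0: "fps_expm1 \<noteq> 0"
  unfolding fps_expm1_def using subdegree_fps_exp_minus_1[where 'a = real] by force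

definition bern_fps :: "nat \<Rightarrow> real \<Rightarrow> real fps" where
  "bern_fps r t = fps_X ^ r / fps_expm1 ^ r * fps_exp t"

lemma fps_nth_bern_fps: "fps_nth (bern_fps r t) n = gen_bernpoly r n t / fact n"
  by (simp add: bern_fps_def gen_bernpoly_def fps_expm1_def)

lemma bern_fps_times: "bern_fps r t * fps_expm1 ^ r = fps_X ^ r * fps_exp t"
  unfolding bern_fps_def fps_expm1_def by (rule fps_bern_times)

lemma fps_expm1_power_cancel:
  assumes "F * fps_expm1 ^ r = G * fps_expm1 ^ r"
  shows "F = G"
  using assms fps_expm1_neq_0 by simp

text \<open>Formal quotients are awkward to compute with; this characterization of \<open>bern_fps r t\<close> avoids
  them, since \<open>fps_expm1\<close> is no zero divisor.\<close>

lemma bern_fps_unique: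
  assumes "F * fps_expm1 ^ r = fps_X ^ r * fps_exp t"
  shows "F = bern_fps r t"
  by (rule fps_expm1_power_cancel[of _ r]) (simp only: assms bern_fps_times)

lemma bern_fps_mult: "bern_fps r t * bern_fps s u = bern_fps (r + s) (t + u)"
proof (rule bern_fps_unique)
  have "bern_fps r t * bern_fps s u * fps_expm1 ^ (r + s) = (bern_fps r t * fps_expm1 ^ r) * (bern_fps s u * fps_expm1 ^ s)"
    by (simp add: power_add mult_ac)
  also have "\<dots> = fps_X ^ (r + s) * fps_exp (t + u)"
    unfolding bern_fps_times by (simp add: power_add fps_exp_add_mult mult_ac)
  finally show "bern_fps r t * bern_fps s u * fps_expm1 ^ (r + s) = fps_X ^ (r + s) * fps_exp (t + u)" .
qed

lemma bern_fps_0: "bern_fps 0 t = fps_exp t"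
  by (simp add: bern_fps_def)

lemma bern_fps_power: "bern_fps 1 0 ^ r = bern_fps r 0"
  by (induction r) (simp_all add: bern_fps_0 bern_fps_mult)

text \<open>The difference operator $t \mapsto t + 1$ multiplies $e^{tx}$ by $e^x - 1$ and so cancels one
  denominator. This is the analogue of Pascal's rule.\<close>

lemma bern_fps_Suc_diff:
  "bern_fps (Suc r) (t + 1) - bern_fps (Suc r) t = fps_X * bern_fps r t"
proof (rule fps_expm1_power_cancel)
  have "(bern_fps (Suc r) (t + 1) - bern_fps (Suc r) t) * fps_expm1 ^ Suc r
        = fps_X ^ Suc r * fps_exp (t + 1) - fps_X ^ Suc r * fps_exp t"
    by (simp only: left_diff_distrib bern_fps_times)
  also have "\<dots> = fps_X ^ Suc r * (fps_exp t * fps_expm1)"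
    by (simp add: fps_expm1_def fps_exp_add_mult right_diff_distrib)
  also have "\<dots> = fps_X * (fps_X ^ r * fps_exp t) * fps_expm1"
    by (simp add: mult_ac)
  also have "\<dots> = fps_X * bern_fps r t * fps_expm1 ^ Suc r"
    unfolding bern_fps_times[of r t, symmetric] power_Suc by (simp only: mult_ac)
  finally show "(bern_fps (Suc r) (t + 1) - bern_fps (Suc r) t) * fps_expm1 ^ Suc r
        = fps_X * bern_fps r t * fps_expm1 ^ Suc r" .
qed

text \<open>For $u = x/(e^x-1)$ this is the differential equation $x u' = u - u^2 e^x$.\<close>

lemma bern_fps_deriv:
  "fps_X * fps_deriv (bern_fps 1 0) = bern_fps 1 0 - bern_fps 2 1"
proof (rule fps_expm1_power_cancel)
  let ?U = "bern_fps 1 0"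
  have UD: "?U * fps_expm1 = fps_X" using bern_fps_times[of 1 0] by simp
  have "fps_deriv fps_expm1 = fps_exp 1" by (simp add: fps_expm1_def)
  hence deriv: "fps_deriv ?U * fps_expm1 = 1 - ?U * fps_exp 1"
    using arg_cong[OF UD, of fps_deriv] by (simp add: algebra_simps)
  have "bern_fps 2 1 * fps_expm1 = ?U * (bern_fps 1 1 * fps_expm1)"
    using bern_fps_mult[of 1 0 1 1] by (simp add: numeral_2_eq_2 flip: mult.assoc)
  also have "bern_fps 1 1 * fps_expm1 = fps_X * fps_exp 1"
    using bern_fps_times[of 1 1] by simp
  finally have B2: "bern_fps 2 1 * fps_expm1 = ?U * (fps_X * fps_exp 1)" .
  have "fps_X * fps_deriv ?U * fps_expm1 = fps_X * (1 - ?U * fps_exp 1)"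
    by (simp only: mult.assoc deriv)
  also have "\<dots> = fps_X - ?U * (fps_X * fps_exp 1)"
    by (simp add: right_diff_distrib mult_ac)
  also have "\<dots> = (?U - bern_fps 2 1) * fps_expm1"
    by (simp only: left_diff_distrib UD B2)
  finally show "fps_X * fps_deriv ?U * fps_expm1 ^ 1 = (?U - bern_fps 2 1) * fps_expm1 ^ 1"
    by simp
qed

text \<open>Analytically, the coefficient in question is the residue at \<open>0\<close> of $e^x/(e^x-1)^{n+1}$, and it
  vanishes because this function is the derivative of $-1/(n (e^x-1)^n)$. Formally,
  \<open>bern_fps_deriv\<close> gives $x (u^n)' = n (u^n - u^{n+1} e^x)$ for $u = x/(e^x-1)$. The coefficients of
  $x^n$ in $x (u^n)'$ and in $n u^n$ agree, so the one in $u^{n+1} e^x$ must be \<open>0\<close>.\<close>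

lemma bern_fps_nth_base:
  assumes "n > 0"
  shows "fps_nth (bern_fps (Suc n) 1) n = 0"
proof -
  obtain k where k: "n = Suc k" using assms by (cases n) auto
  let ?U = "bern_fps 1 0"
  have "fps_X * fps_deriv (bern_fps n 0) = of_nat n * bern_fps k 0 * (fps_X * fps_deriv ?U)"
    using fps_deriv_power'[of ?U n]
    unfolding bern_fps_power k diff_Suc_1 by (simp only: mult_ac)
  also have "\<dots> = of_nat n * (bern_fps n 0 - bern_fps (Suc n) 1)"
    unfolding bern_fps_deriv by (simp add: mult.assoc right_diff_distrib bern_fps_mult k)
  finally have "fps_nth (fps_X * fps_deriv (bern_fps n 0)) n
      = fps_nth (of_nat n * (bern_fps n 0 - bern_fps (Suc n) 1)) n" by (rule arg_cong)
  thus ?thesis by (simp add: k fps_mult_of_nat_nth del: of_nat_Suc)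
qed

text \<open>Both sides are \<open>1\<close> for \<open>n = 0\<close>. For \<open>n > 0\<close> they vanish at \<open>t = 0\<close> (\<open>bern_fps_nth_base\<close>), and
  by Pascal's rule and \<open>bern_fps_Suc_diff\<close> their differences in \<open>t\<close> are the two sides for
  \<open>n - 1\<close>.\<close>

lemma bern_fps_nth_binomial:
  "fps_nth (bern_fps (Suc n) (real t + 1)) n = real (t choose n)"
proof (induction n arbitrary: t)
  case 0
  have "fps_nth (bern_fps 1 (real t + 1) * fps_expm1) 1 = 1"
    using bern_fps_times[of 1 "real t + 1"] by simp
  thus ?case by (simp add: fps_mult_nth_1 fps_expm1_def)
next
  case (Suc n)
  note outer = Suc.IH
  show ?case
  proof (induction t)
    case 0
    show ?case using bern_fps_nth_base[of "Suc n"] by simp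
  next
    case (Suc t)
    have "fps_nth (bern_fps (Suc (Suc n)) (real t + 1 + 1)) (Suc n)
        - fps_nth (bern_fps (Suc (Suc n)) (real t + 1)) (Suc n)
        = fps_nth (bern_fps (Suc n) (real t + 1)) n"
      using arg_cong[OF bern_fps_Suc_diff[of "Suc n" "real t + 1"], of "\<lambda>F. fps_nth F (Suc n)"]
      by simp
    thus ?case using Suc.IH outer by (simp add: add_ac)
  qed
qed

text \<open>The series is $(x/(e^{x/2}-e^{-x/2}))^{2k}$, which is even in $x$. Below, \<open>h\<close> is the
  substitution of $-x$ for $x$.\<close>

lemma bern_fps_parity:
  assumes "odd n"
  shows "fps_nth (bern_fps (2 * k) (real k)) n = 0"
proof -
  define h :: "real fps \<Rightarrow> real fps" where "h = (\<lambda>F. Abs_fps (\<lambda>n. (-1) ^ n * fps_nth F n))"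
  have h_mult: "h (F * G) = h F * h G" for F G
  proof (rule fps_ext)
    fix n
    have sign: "(- 1) ^ n * (fps_nth F i * fps_nth G (n - i))
       = (- 1) ^ i * fps_nth F i * ((- 1) ^ (n - i) * fps_nth G (n - i))" if "i \<le> n" for i
    proof -
      have "(- 1 :: real) ^ n = (- 1) ^ i * (- 1) ^ (n - i)" using that
        by (simp flip: power_add)
      thus ?thesis by simp
    qed
    have "fps_nth (h (F * G)) n = (\<Sum>i=0..n. (- 1) ^ n * (fps_nth F i * fps_nth G (n - i)))"
      by (simp add: h_def fps_mult_nth sum_distrib_left)
    also have "\<dots> = fps_nth (h F * h G) n"
      unfolding fps_mult_nth by (intro sum.cong refl) (use sign in \<open>simp add: h_def\<close>)
    finally show "fps_nth (h (F * G)) n = fps_nth (h F * h G) n" .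
  qed
  have h_1: "h 1 = 1" by (rule fps_ext) (simp add: h_def)
  have h_power: "h (F ^ k) = h F ^ k" for F k
    by (induction k) (simp_all add: h_1 h_mult)
  have h_X: "h fps_X = - fps_X" by (rule fps_ext) (auto simp: h_def fps_X_def)
  have h_exp: "h (fps_exp u) = fps_exp (- u)" for u
    by (rule fps_ext) (simp add: h_def power_minus[of u])
  have h_D: "h fps_expm1 * fps_exp 1 = - fps_expm1"
  proof -
    have "h fps_expm1 = h (fps_exp 1) - h 1"
      by (rule fps_ext) (simp add: h_def fps_expm1_def right_diff_distrib)
    hence "h fps_expm1 = fps_exp (-1) - 1" by (simp only: h_exp h_1)
    thus ?thesis by (simp add: fps_expm1_def left_diff_distrib flip: fps_exp_add_mult)
  qed
  let ?B = "bern_fps (2 * k) (real k)"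
  have "h ?B * h fps_expm1 ^ (2 * k) = (- fps_X) ^ (2 * k) * fps_exp (- real k)"
    using arg_cong[OF bern_fps_times[of "2 * k" "real k"], of h]
    by (simp add: h_mult h_power h_X h_exp)
  hence "h ?B * (h fps_expm1 * fps_exp 1) ^ (2 * k)
      = fps_X ^ (2 * k) * (fps_exp (- real k) * fps_exp 1 ^ (2 * k))"
    by (simp add: power_mult_distrib mult_ac)
  also have "fps_exp (- real k) * fps_exp 1 ^ (2 * k) = fps_exp (real k)"
    by (simp add: fps_exp_power_mult flip: fps_exp_add_mult)
  finally have "h ?B = ?B"
    unfolding h_D by (intro bern_fps_unique) simp
  from arg_cong[OF this, of "\<lambda>F. fps_nth F n"] assms show ?thesis
    by (simp add: h_def)
qed

section \<open>A binomial coefficient as an odd polynomial\<close>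

text \<open>The coefficient of $x^{2m+1}$ in $e^{jx} \cdot (x/(e^x-1))^{2m+2} e^{(m+1)x}$ is computed twice:
  in closed form by \<open>bern_fps_nth_binomial\<close>, and as a Cauchy product, where the terms with an even
  power of \<open>j\<close> drop out by \<open>bern_fps_parity\<close>.\<close>

lemma binomial_eq_sum_odd_powers:
  "real (j + m choose (2 * m + 1)) =
     (\<Sum>i\<le>m. c_coeff m i / fact (2 * m + 1) * real j ^ (2 * i + 1))"
proof -
  let ?k = "2 * m + 1"
  let ?B = "bern_fps (2 * m + 2) (real m + 1)"
  let ?a = "\<lambda>l. real j ^ l / fact l * fps_nth ?B (?k - l)"
  have "real (j + m choose ?k) = fps_nth (bern_fps (2 * m + 2) (real (j + m) + 1)) ?k"
    using bern_fps_nth_binomial[of ?k "j + m"] by simp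
  also have "bern_fps (2 * m + 2) (real (j + m) + 1) = fps_exp (real j) * ?B"
    unfolding bern_fps_0[symmetric] bern_fps_mult by (simp add: add_ac)
  also have "fps_nth \<dots> ?k = (\<Sum>l=0..?k. ?a l)"
    by (simp add: fps_mult_nth)
  also have "\<dots> = (\<Sum>l\<in>(\<lambda>i. 2 * i + 1) ` {..m}. ?a l)"
  proof (rule sum.mono_neutral_right)
    show "\<forall>l\<in>{0..?k} - (\<lambda>i. 2 * i + 1) ` {..m}. ?a l = 0"
    proof
      fix l assume l: "l \<in> {0..?k} - (\<lambda>i. 2 * i + 1) ` {..m}"
      have "even l"
      proof (rule ccontr)
        assume "odd l"
        then obtain i where "l = 2 * i + 1" by (elim oddE)
        with l show False by auto
      qed
      hence "odd (?k - l)" using l by simp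
      hence "fps_nth ?B (?k - l) = 0"
        using bern_fps_parity[of "?k - l" "m + 1"] by (simp add: add_ac)
      thus "?a l = 0" by simp
    qed
  qed auto
  also have "\<dots> = (\<Sum>i\<le>m. ?a (2 * i + 1))"
    by (subst sum.reindex) (auto simp: inj_on_def)
  also have "\<dots> = (\<Sum>i\<le>m. c_coeff m i / fact ?k * real j ^ (2 * i + 1))"
    by (intro sum.cong refl) (simp add: c_coeff_def fps_nth_bern_fps del: fact_Suc)
  finally show ?thesis .
qed

section \<open>Power series expansion of a single term\<close>

lemma negative_binomial_sums:
  fixes y :: complex
  assumes "norm y < 1"
  shows "(\<lambda>n. of_nat (n + k choose k) * y ^ n) sums (1 / (1 - y) ^ Suc k)"
proof -
  have "(\<lambda>n. ((- of_nat (Suc k)) gchoose n) * (- y) ^ n) sums (1 + (- y)) powr (- of_nat (Suc k))"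
    using assms by (intro gen_binomial_complex) simp
  also have "(1 + (- y)) powr (- of_nat (Suc k)) = 1 / (1 - y) ^ Suc k"
  proof -
    have "1 - y \<noteq> 0" using assms by auto
    thus ?thesis by (simp add: powr_minus powr_nat' divide_inverse del: power_Suc of_nat_Suc)
  qed
  also have "(\<lambda>n. ((- of_nat (Suc k)) gchoose n) * (- y) ^ n)
             = (\<lambda>n. of_nat (n + k choose k) * y ^ n)"
  proof
    fix n
    have "((- of_nat (Suc k)) gchoose n) = (-1) ^ n * (of_nat (n + k) gchoose n :: complex)"
      by (subst gbinomial_minus) (simp add: add_ac)
    also have "(of_nat (n + k) gchoose n :: complex) = of_nat (n + k choose n)"
      by (rule binomial_gbinomial[symmetric])
    also have "n + k choose n = n + k choose k"
      using binomial_symmetric[of k "n + k"] by simp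
    finally show "((- of_nat (Suc k)) gchoose n) * (- y) ^ n = of_nat (n + k choose k) * y ^ n"
      by (simp add: mult_ac flip: power_mult_distrib)
  qed
  finally show ?thesis .
qed

text \<open>\<open>negative_binomial_sums\<close> times \<open>y ^ (m + 1)\<close>: the shifted series starts at the exponent
  \<open>m + 1\<close>, which is also the first one whose binomial coefficient does not vanish, so the sum may run
  over all positive exponents.\<close>

lemma shifted_binomial_sums:
  fixes y :: complex
  assumes "norm y < 1"
  shows "(\<lambda>j. of_nat (Suc j + m choose (2 * m + 1)) * y ^ Suc j) sums
           (y ^ (m + 1) / (1 - y) ^ (2 * m + 2))"
proof -
  let ?f = "\<lambda>j. of_nat (Suc j + m choose (2 * m + 1)) * y ^ Suc j"
  have "(\<lambda>n. y ^ (m + 1) * (of_nat (n + (2 * m + 1) choose (2 * m + 1)) * y ^ n)) sums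
          (y ^ (m + 1) * (1 / (1 - y) ^ Suc (2 * m + 1)))"
    by (intro sums_mult negative_binomial_sums assms)
  also have "(\<lambda>n. y ^ (m + 1) * (of_nat (n + (2 * m + 1) choose (2 * m + 1)) * y ^ n))
             = (\<lambda>n. ?f (n + m))"
  proof
    fix n
    have "Suc (n + m) + m = n + (2 * m + 1)" by simp
    thus "y ^ (m + 1) * (of_nat (n + (2 * m + 1) choose (2 * m + 1)) * y ^ n) = ?f (n + m)"
      by (simp only:) (simp add: power_add)
  qed
  finally have "(\<lambda>n. ?f (n + m)) sums (y ^ (m + 1) / (1 - y) ^ (2 * m + 2))" by simp
  moreover have "(\<Sum>j<m. ?f j) = 0" by (intro sum.neutral) (auto simp: binomial_eq_0)
  ultimately show ?thesis using sums_iff_shift[of ?f m] by simp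
qed

section \<open>Lambert series as double series\<close>

lemma geometric_sums_Suc:
  fixes y :: "'a :: {real_normed_field, banach}"
  assumes "norm y < 1"
  shows "(\<lambda>n. y ^ Suc n) sums (y / (1 - y))"
  using sums_mult[OF geometric_sums[OF assms], of y] by simp

text \<open>The order of summation is the opposite of the one that is natural for the Lambert series. The
  interchange is justified by absolute convergence: summed over \<open>n\<close> first, the absolute values give
  the Lambert series at \<open>norm q\<close>, which converges.\<close>

lemma lambert_double_sum:
  fixes q :: complex
  assumes "norm q < 1"
  shows "summable (\<lambda>j. of_real (real (Suc j) powr s) * (q ^ Suc n) ^ Suc j)"
    and "(\<lambda>n. \<Sum>j. of_real (real (Suc j) powr s) * (q ^ Suc n) ^ Suc j) sums lambert q s"
proof -
  define f :: "nat \<Rightarrow> nat \<Rightarrow> complex"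
    where "f j n = of_real (real (Suc j) powr s) * (q ^ Suc j) ^ Suc n" for j n
  define x where "x = norm q"
  have x: "0 \<le> x" "x < 1" using assms by (auto simp: x_def)
  have lt: "norm (q ^ Suc j) < 1" for j
    using assms by (simp add: norm_power power_less_one_iff del: power_Suc)
  have row: "(\<lambda>n. f j n) sums (of_real (real (Suc j) powr s) * q ^ Suc j / (1 - q ^ Suc j))" for j
    unfolding f_def times_divide_eq_right[symmetric]
    by (intro sums_mult geometric_sums_Suc lt)
  have nrow: "(\<lambda>n. norm (f j n)) sums (real (Suc j) powr s * x ^ Suc j / (1 - x ^ Suc j))" for j
  proof -
    have "norm (f j n) = real (Suc j) powr s * (x ^ Suc j) ^ Suc n" for n
      by (simp only: f_def x_def norm_mult norm_power norm_of_real) simp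
    moreover have "(\<lambda>n. real (Suc j) powr s * (x ^ Suc j) ^ Suc n) sums
        (real (Suc j) powr s * (x ^ Suc j / (1 - x ^ Suc j)))"
      using lt[of j]
      by (intro sums_mult geometric_sums_Suc) (simp add: x_def norm_power del: power_Suc)
    ultimately show ?thesis by simp
  qed
  have "summable (\<lambda>j. complex_of_real (real (Suc j) powr s * x ^ Suc j / (1 - x ^ Suc j)))"
    using summable_lambert[of "of_real x" s] x by simp
  hence outer: "summable (\<lambda>j. real (Suc j) powr s * x ^ Suc j / (1 - x ^ Suc j))"
    by (simp only: summable_complex_of_real)
  have abs: "(\<lambda>p. norm (case p of (j, n) \<Rightarrow> f j n)) summable_on UNIV \<times> UNIV"
  proof (subst Infinite_Sum.abs_summable_on_Sigma_iff, intro conjI ballI)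
    fix j show "(\<lambda>n. norm (case (j, n) of (j, n) \<Rightarrow> f j n)) summable_on UNIV"
      using nrow[of j] by (auto intro!: norm_summable_imp_summable_on simp: sums_iff)
  next
    have inf: "infsum (\<lambda>n. norm (f j n)) UNIV = real (Suc j) powr s * x ^ Suc j / (1 - x ^ Suc j)" for j
      using nrow[of j] by (intro infsumI norm_summable_imp_has_sum) (auto simp: sums_iff)
    have nonneg: "\<bar>real (Suc j) powr s * x ^ Suc j / (1 - x ^ Suc j)\<bar>
        = real (Suc j) powr s * x ^ Suc j / (1 - x ^ Suc j)" for j
      unfolding inf[symmetric] by (simp add: infsum_nonneg)
    show "(\<lambda>j. norm (infsum (\<lambda>n. norm (case (j, n) of (j, n) \<Rightarrow> f j n)) UNIV)) summable_on UNIV"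
      unfolding prod.case
      by (rule norm_summable_imp_summable_on) (simp only: inf real_norm_def nonneg outer)
  qed
  hence sm: "(\<lambda>(j, n). f j n) summable_on UNIV \<times> UNIV"
    by (rule Infinite_Sum.abs_summable_summable)
  then obtain T where T: "((\<lambda>(j, n). f j n) has_sum T) (UNIV \<times> UNIV)"
    by (auto simp: summable_on_def)
  have "((\<lambda>j. of_real (real (Suc j) powr s) * q ^ Suc j / (1 - q ^ Suc j)) has_sum T) UNIV"
  proof (rule has_sum_SigmaD[OF T])
    fix j show "((\<lambda>n. case (j, n) of (j, n) \<Rightarrow> f j n) has_sum
        of_real (real (Suc j) powr s) * q ^ Suc j / (1 - q ^ Suc j)) UNIV"
      using nrow[of j] row[of j]
      by (auto intro!: norm_summable_imp_has_sum simp: sums_iff)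
  qed
  hence "T = lambert q s"
    unfolding lambert_def by (intro sums_unique has_sum_imp_sums)
  have T': "((\<lambda>(n, j). f j n) has_sum T) (UNIV \<times> UNIV)"
    using T by (subst has_sum_swap) (simp add: case_prod_unfold)
  have flip: "f j n = of_real (real (Suc j) powr s) * (q ^ Suc n) ^ Suc j" for j n
    by (simp only: f_def power_mult[symmetric] mult.commute[of "Suc j"])
  have col: "(\<lambda>j. f j n) summable_on UNIV" for n
    by (rule summable_on_SigmaD1[where f = "\<lambda>n j. f j n", OF has_sum_imp_summable[OF T']]) simp
  have "summable (\<lambda>j. f j n)"
    using col by (rule summable_on_imp_summable)
  thus "summable (\<lambda>j. of_real (real (Suc j) powr s) * (q ^ Suc n) ^ Suc j)"
    by (simp only: flip)
  have "((\<lambda>n. \<Sum>j. f j n) has_sum T) UNIV"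
  proof (rule has_sum_SigmaD[OF T'])
    fix n
    from col obtain S where S: "((\<lambda>j. f j n) has_sum S) UNIV" by (auto simp: summable_on_def)
    moreover have "S = (\<Sum>j. f j n)"
      using has_sum_imp_sums[OF S] by (rule sums_unique)
    ultimately show "((\<lambda>j. case (n, j) of (n, j) \<Rightarrow> f j n) has_sum (\<Sum>j. f j n)) UNIV"
      by simp
  qed
  hence "(\<lambda>n. \<Sum>j. f j n) sums lambert q s"
    unfolding \<open>T = _\<close> by (rule has_sum_imp_sums)
  thus "(\<lambda>n. \<Sum>j. of_real (real (Suc j) powr s) * (q ^ Suc n) ^ Suc j) sums lambert q s"
    by (simp only: flip)
qed

section \<open>Powers of the hyperbolic sine and Lambert series\<close>

lemma inverse_sinh_even_power:
  fixes w :: complex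
  shows "1 / sinh w ^ (2 * k) = 2 ^ (2 * k) * (exp (- 2 * w) ^ k / (1 - exp (- 2 * w)) ^ (2 * k))"
proof -
  define d where "d = 1 - exp (- 2 * w)"
  have sinh: "sinh w = exp w * d / 2"
    by (simp add: d_def sinh_field_def algebra_simps flip: exp_add)
  have "1 / sinh w ^ (2 * k) = 2 ^ (2 * k) * (exp (- w) ^ (2 * k) / d ^ (2 * k))"
    unfolding sinh power_mult_distrib power_divide exp_minus power_inverse
    by (simp add: divide_inverse)
  also have "exp (- w) ^ (2 * k) = exp (- 2 * w) ^ k"
    by (simp add: power_mult flip: exp_double)
  finally show ?thesis by (simp only: d_def)
qed

theorem proposition1p2:
  fixes m :: nat and \<phi> :: complex and \<sigma> :: real
  assumes "Re \<phi> \<noteq> 0" and "\<sigma> = sgn (Re \<phi>)"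
  shows "S_series (2 * m + 2) \<phi> =
    (2 * \<phi>) ^ (2 * m + 2) / fact (2 * m + 1) *
      (\<Sum>i=0..m. of_real (c_coeff m i) * lambert (exp (- of_real \<sigma> * \<phi>)) (real (2 * i + 1)))"
proof -
  define q where "q = exp (- of_real \<sigma> * \<phi>)"
  have \<sigma>: "\<sigma> = 1 \<or> \<sigma> = - 1" using assms by (auto simp: sgn_if)
  have q: "norm q < 1" using assms by (auto simp: q_def sgn_if)
  define A where "A = (\<lambda>i. complex_of_real (c_coeff m i) / fact (2 * m + 1))"
  define L where "L = (\<lambda>i n. \<Sum>j. of_real (real (Suc j) powr real (2 * i + 1)) * (q ^ Suc n) ^ Suc j)"
  have nth_term: "\<phi> ^ (2 * m + 2) / sinh (of_nat (Suc n) * \<phi> / 2) ^ (2 * m + 2)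
      = (2 * \<phi>) ^ (2 * m + 2) * (\<Sum>i\<le>m. A i * L i n)" for n
  proof -
    \<comment> \<open>The sign is moved into the argument so that \<open>exp (- 2 * w)\<close> lies in the unit disc.\<close>
    define w where "w = of_real \<sigma> * (of_nat (Suc n) * \<phi> / 2)"
    define y where "y = q ^ Suc n"
    have y: "norm y < 1" using q
      by (simp add: y_def norm_power power_less_one_iff del: power_Suc)
    have y_exp: "y = exp (- 2 * w)"
      unfolding y_def q_def w_def exp_of_nat_mult[symmetric]
      by (rule arg_cong[of _ _ exp]) (simp del: of_nat_Suc)
    have "sinh (of_nat (Suc n) * \<phi> / 2) ^ (2 * (m + 1)) = sinh w ^ (2 * (m + 1))"
      using \<sigma> by (auto simp: w_def simp del: of_nat_Suc)
    hence "1 / sinh (of_nat (Suc n) * \<phi> / 2) ^ (2 * m + 2)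
        = 2 ^ (2 * m + 2) * (y ^ (m + 1) / (1 - y) ^ (2 * m + 2))"
      using inverse_sinh_even_power[of w "m + 1"] y_exp by simp
    also have "y ^ (m + 1) / (1 - y) ^ (2 * m + 2) = (\<Sum>i\<le>m. A i * L i n)"
    proof (rule sums_unique2[OF shifted_binomial_sums[OF y]])
      have sm: "summable (\<lambda>j. complex_of_real (real (Suc j) powr real (2 * i + 1)) * y ^ Suc j)" for i
        unfolding y_def by (rule lambert_double_sum(1)[OF q])
      have "(\<lambda>j. \<Sum>i\<le>m. A i * (of_real (real (Suc j) powr real (2 * i + 1)) * y ^ Suc j))
          sums (\<Sum>i\<le>m. A i * L i n)"
        unfolding L_def y_def[symmetric] by (intro sums_sum sums_mult summable_sums sm)
      also have "(\<lambda>j. \<Sum>i\<le>m. A i * (of_real (real (Suc j) powr real (2 * i + 1)) * y ^ Suc j))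
          = (\<lambda>j. of_nat (Suc j + m choose (2 * m + 1)) * y ^ Suc j)"
      proof
        fix j
        have "complex_of_nat (Suc j + m choose (2 * m + 1))
            = of_real (\<Sum>i\<le>m. c_coeff m i / fact (2 * m + 1) * real (Suc j) ^ (2 * i + 1))"
          unfolding binomial_eq_sum_odd_powers[symmetric] by simp
        also have "\<dots> = (\<Sum>i\<le>m. A i * of_real (real (Suc j) powr real (2 * i + 1)))"
          by (simp add: A_def powr_realpow del: of_nat_Suc fact_Suc power_Suc of_nat_add of_nat_mult)
        finally show "(\<Sum>i\<le>m. A i * (of_real (real (Suc j) powr real (2 * i + 1)) * y ^ Suc j))
            = of_nat (Suc j + m choose (2 * m + 1)) * y ^ Suc j"
          by (simp only: sum_distrib_right mult.assoc)
      qed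
      finally show "(\<lambda>j. of_nat (Suc j + m choose (2 * m + 1)) * y ^ Suc j)
          sums (\<Sum>i\<le>m. A i * L i n)" .
    qed
    finally have "\<phi> ^ (2 * m + 2) * (1 / sinh (of_nat (Suc n) * \<phi> / 2) ^ (2 * m + 2))
        = \<phi> ^ (2 * m + 2) * (2 ^ (2 * m + 2) * (\<Sum>i\<le>m. A i * L i n))"
      by (rule arg_cong)
    thus ?thesis by (simp only: times_divide_eq_right mult_1_left mult_1_right power_mult_distrib mult_ac)
  qed
  have "(\<lambda>n. (2 * \<phi>) ^ (2 * m + 2) * (\<Sum>i\<le>m. A i * L i n)) sums
      ((2 * \<phi>) ^ (2 * m + 2) * (\<Sum>i\<le>m. A i * lambert q (real (2 * i + 1))))"
    unfolding L_def by (intro sums_mult sums_sum lambert_double_sum q)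
  hence "S_series (2 * m + 2) \<phi> =
      (2 * \<phi>) ^ (2 * m + 2) * (\<Sum>i\<le>m. A i * lambert q (real (2 * i + 1)))"
    unfolding S_series_def nth_term by (rule sums_unique[symmetric])
  thus ?thesis
    unfolding A_def q_def atLeast0AtMost
    by (simp only: times_divide_eq_left times_divide_eq_right sum_divide_distrib[symmetric])
qed

end
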